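(* Let $n\ge0$, $\pi\in S_n(132)$, and let $\mu$ be defined below. Then $$\bigl(C(\mu(\pi)),\,\mathsf{des}(\mu(\pi)),\,L(\mu(\pi))\bigr)=\bigl(B(\pi),\,\mathsf{des}(\pi),\,L(\pi)\bigr).$$
   Context: $S_n$ is the set of permutations of $\{1,\dots,n\}$ in one-line notation $\pi=\pi_1\cdots\pi_n$; $S_n(132)$ those avoiding the classical pattern $132$. Statistics: $\mathsf{des}(\pi)=\mathrm{card}\{i<n:\pi_i>\pi_{i+1}\}$; $B(\pi)=\mathrm{card}\{(i,j):1\le i<j\le n-1,\ \pi_j<\pi_i<\pi_{j+1}\}$ (vincular pattern $2\text{-}\underline{13}$); $C(\pi)=\mathrm{card}\{(i,k):1\le i,\ i+1<k\le n,\ \pi_{i+1}<\pi_i<\pi_k\}$ (vincular pattern $\underline{21}\text{-}3$); $L(\pi)=\mathrm{card}\{i<n:\pi_i<\pi_n\}=\pi_n-1$ for $n\ge1$, and all statistics are $0$ on the empty permutation $\varepsilon$. For permutations $\alpha$ (length $a$), $\beta$ (length $b$): $\alpha\oplus\beta$ has entries $\alpha_i$ ($i\le a$) and $\beta_{i-a}+a$ ($i>a$); $\alpha\ominus\beta$ has entries $\alpha_i+b$ ($i\le a$) and $\beta_{i-a}$ ($i>a$); $1$ is the length-one permutation. A nonempty $132$-avoiding permutation can be written uniquely as $(\alpha\oplus1)\ominus\beta$ and also uniquely as $\alpha\ominus(\beta\oplus1)$, with $\alpha,\beta$ possibly empty $132$-avoiding. Map $\psi$ (a bijection of each $S_n(132)$;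 set $\psi(\varepsilon)=\varepsilon$): $\psi(1)=1$; for $\pi\in S_n(132)$, $n\ge2$: (i) if $\pi=1\ominus\alpha$, $\psi(\pi)=1\ominus\psi(\alpha)$; (ii) if $\pi=(\alpha\oplus1)\ominus\beta$ with $\alpha,\beta$ nonempty, write $\psi(\beta)=\gamma\ominus(\delta\oplus1)$ and set $\psi(\pi)=((\psi(\alpha)\ominus(\delta\oplus1))\oplus1)\ominus\gamma$; (iii) if $\pi=\alpha\oplus1$ with $\alpha$ nonempty, write $\psi(\alpha)=(\gamma\oplus1)\ominus\delta$ and set $\psi(\pi)=((\gamma\oplus1)\oplus1)\ominus\delta$. Map $\mu$: $\mu(\varepsilon)=\varepsilon$, and for nonempty $\pi=\alpha\ominus(\beta\oplus1)$ in $S_n(132)$, $\mu(\pi)=\mu(\alpha)\ominus(\mu(\psi(\beta))\oplus1)$. *)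

theory Defs
  imports Main "HOL-Combinatorics.Multiset_Permutations"
begin

text \<open>
  A permutation of \<open>{1..n}\<close> is its one-line notation, a list of naturals. Entries run from \<open>1\<close>
  to \<open>n\<close>, but positions follow \<^const>\<open>nth\<close> and start at \<open>0\<close>.
\<close>

definition perms :: "nat \<Rightarrow> nat list set" where
  "perms n = permutations_of_set {1..n}"

definition avoids_132 :: "nat list \<Rightarrow> bool" where
  "avoids_132 \<pi> \<longleftrightarrow>
    \<not> (\<exists>i j k. i < j \<and> j < k \<and> k < length \<pi> \<and> \<pi> ! i < \<pi> ! k \<and> \<pi> ! k < \<pi> ! j)"

definition perms_132 :: "nat \<Rightarrow> nat list set" where
  "perms_132 n = {\<pi> \<in> perms n. avoids_132 \<pi>}"

definition des :: "nat list \<Rightarrow> nat" where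
  "des \<pi> = card {i. i + 1 < length \<pi> \<and> \<pi> ! i > \<pi> ! (i + 1)}"

definition stat_B :: "nat list \<Rightarrow> nat" where
  "stat_B \<pi> = card {(i, j). i < j \<and> j + 1 < length \<pi> \<and> \<pi> ! j < \<pi> ! i \<and> \<pi> ! i < \<pi> ! (j + 1)}"

definition stat_C :: "nat list \<Rightarrow> nat" where
  "stat_C \<pi> = card {(i, k). i + 1 < k \<and> k < length \<pi> \<and> \<pi> ! (i + 1) < \<pi> ! i \<and> \<pi> ! i < \<pi> ! k}"

definition stat_L :: "nat list \<Rightarrow> nat" where
  "stat_L \<pi> = card {i. i + 1 < length \<pi> \<and> \<pi> ! i < last \<pi>}"

definition osum :: "nat list \<Rightarrow> nat list \<Rightarrow> nat list"  (infixl "\<oplus>" 65) where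
  "\<alpha> \<oplus> \<beta> = \<alpha> @ map (\<lambda>x. x + length \<alpha>) \<beta>"

definition ominus :: "nat list \<Rightarrow> nat list \<Rightarrow> nat list"  (infixl "\<ominus>" 65) where
  "\<alpha> \<ominus> \<beta> = map (\<lambda>x. x + length \<beta>) \<alpha> @ \<beta>"

text \<open>
  The two decompositions of a nonempty permutation are computed explicitly: \<open>split_max\<close> cuts at
  the largest entry and inverts \<open>(\<alpha>, \<beta>) \<mapsto> (\<alpha> \<oplus> 1) \<ominus> \<beta>\<close>, while \<open>split_last\<close> reads the length of \<open>\<beta>\<close>
  off the last entry and inverts \<open>(\<alpha>, \<beta>) \<mapsto> \<alpha> \<ominus> (\<beta> \<oplus> 1)\<close>; see \<open>split_max_eq\<close> and
  \<open>split_last_eq\<close> below. On lists that are not 132-avoiding permutations the values are junk.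
\<close>

definition split_max :: "nat list \<Rightarrow> nat list \<times> nat list" where
  "split_max \<pi> =
    (let m = Max (set \<pi>); \<beta> = tl (dropWhile (\<lambda>x. x \<noteq> m) \<pi>)
     in (map (\<lambda>x. x - length \<beta>) (takeWhile (\<lambda>x. x \<noteq> m) \<pi>), \<beta>))"

definition split_last :: "nat list \<Rightarrow> nat list \<times> nat list" where
  "split_last \<pi> =
    (let k = length \<pi> - last \<pi>
     in (map (\<lambda>x. x - last \<pi>) (take k (butlast \<pi>)), drop k (butlast \<pi>)))"

lemma split_max_eq:
  assumes "\<alpha> \<in> perms a" "\<beta> \<in> perms b"
  shows "split_max ((\<alpha> \<oplus> [1]) \<ominus> \<beta>) = (\<alpha>, \<beta>)"
proof -
  have sets: "set \<alpha> = {1..a}" "set \<beta> = {1..b}" and len: "length \<alpha> = a" "length \<beta> = b"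
    using assms by (auto simp: perms_def permutations_of_set_def distinct_card[symmetric])
  have eq: "(\<alpha> \<oplus> [1]) \<ominus> \<beta> = map (\<lambda>x. x + b) \<alpha> @ (a + b + 1) # \<beta>"
    by (simp add: osum_def ominus_def len)
  have "Max (set (map (\<lambda>x. x + b) \<alpha> @ (a + b + 1) # \<beta>)) = a + b + 1"
    by (rule Max_eqI) (auto simp: sets)
  moreover have "takeWhile (\<lambda>x. x \<noteq> a + b + 1) (map (\<lambda>x. x + b) \<alpha> @ (a + b + 1) # \<beta>) = map (\<lambda>x. x + b) \<alpha>"
    by (subst takeWhile_append2) (auto simp: sets)
  moreover have "dropWhile (\<lambda>x. x \<noteq> a + b + 1) (map (\<lambda>x. x + b) \<alpha> @ (a + b + 1) # \<beta>) = (a + b + 1) # \<beta>"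
    by (subst dropWhile_append2) (auto simp: sets)
  ultimately show ?thesis
    unfolding eq split_max_def Let_def by (simp only: list.sel len) (simp add: comp_def)
qed

lemma split_last_eq:
  assumes "\<alpha> \<in> perms a" "\<beta> \<in> perms b"
  shows "split_last (\<alpha> \<ominus> (\<beta> \<oplus> [1])) = (\<alpha>, \<beta>)"
  by (simp add: split_last_def Let_def osum_def ominus_def butlast_append comp_def)

lemma length_split_max:
  assumes "\<pi> \<noteq> []" "split_max \<pi> = (\<alpha>, \<beta>)"
  shows "length \<alpha> + length \<beta> + 1 = length \<pi>"
proof -
  define m where "m = Max (set \<pi>)"
  have "m \<in> set \<pi>" using assms(1) by (simp add: m_def)
  then have ne: "dropWhile (\<lambda>x. x \<noteq> m) \<pi> \<noteq> []" by (auto simp: dropWhile_eq_Nil_conv)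
  have "length (takeWhile (\<lambda>x. x \<noteq> m) \<pi>) + length (dropWhile (\<lambda>x. x \<noteq> m) \<pi>) = length \<pi>"
    by (metis length_append takeWhile_dropWhile_id)
  moreover from ne have "length (dropWhile (\<lambda>x. x \<noteq> m) \<pi>) > 0" by blast
  moreover have "length \<alpha> = length (takeWhile (\<lambda>x. x \<noteq> m) \<pi>)"
    and "length \<beta> = length (dropWhile (\<lambda>x. x \<noteq> m) \<pi>) - 1"
    using assms(2) by (auto simp: split_max_def Let_def m_def[symmetric])
  ultimately show ?thesis by linarith
qed

lemma length_split_last:
  assumes "\<pi> \<noteq> []" "split_last \<pi> = (\<alpha>, \<beta>)"
  shows "length \<alpha> + length \<beta> + 1 = length \<pi>"
proof -
  have "length \<pi> > 0" using assms(1) by simp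
  moreover have "length \<alpha> = min (length \<pi> - 1) (length \<pi> - last \<pi>)"
    and "length \<beta> = length \<pi> - 1 - (length \<pi> - last \<pi>)"
    using assms(2) by (auto simp: split_last_def Let_def)
  ultimately show ?thesis by linarith
qed

function psi :: "nat list \<Rightarrow> nat list" where
  "psi \<pi> =
    (if \<pi> = [] then []
     else case split_max \<pi> of (\<alpha>, \<beta>) \<Rightarrow>
       if \<alpha> = [] then [1] \<ominus> psi \<beta>
       else if \<beta> \<noteq> [] then
         (case split_last (psi \<beta>) of (\<gamma>, \<delta>) \<Rightarrow> ((psi \<alpha> \<ominus> (\<delta> \<oplus> [1])) \<oplus> [1]) \<ominus> \<gamma>)
       else
         (case split_max (psi \<alpha>) of (\<gamma>, \<delta>) \<Rightarrow> ((\<gamma> \<oplus> [1]) \<oplus> [1]) \<ominus> \<delta>))"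
  by pat_completeness auto
termination
  by (relation "measure length") (auto dest: length_split_max[OF _ sym])

declare psi.simps [simp del]

lemma length_psi [simp]: "length (psi \<pi>) = length \<pi>"
proof (induction \<pi> rule: length_induct)
  case (1 \<pi>)
  show ?case
  proof (cases "\<pi> = []")
    case True
    then show ?thesis by (simp add: psi.simps)
  next
    case False
    obtain \<alpha> \<beta> where s: "split_max \<pi> = (\<alpha>, \<beta>)" by fastforce
    have len: "length \<alpha> + length \<beta> + 1 = length \<pi>"
      using length_split_max[OF False s] .
    have IH: "length (psi \<alpha>) = length \<alpha>" "length (psi \<beta>) = length \<beta>"
      using 1 len by auto
    obtain \<gamma> \<delta> where t: "split_last (psi \<beta>) = (\<gamma>, \<delta>)" by fastforce
    obtain \<gamma>' \<delta>' where u: "split_max (psi \<alpha>) = (\<gamma>', \<delta>')" by fastforce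
    have "\<beta> \<noteq> [] \<Longrightarrow> length \<gamma> + length \<delta> + 1 = length \<beta>"
      using length_split_last[OF _ t] IH by fastforce
    moreover have "\<alpha> \<noteq> [] \<Longrightarrow> length \<gamma>' + length \<delta>' + 1 = length \<alpha>"
      using length_split_max[OF _ u] IH by fastforce
    ultimately show ?thesis
      using False IH len by (subst psi.simps) (auto simp: s t u osum_def ominus_def)
  qed
qed

function mu :: "nat list \<Rightarrow> nat list" where
  "mu \<pi> =
    (if \<pi> = [] then []
     else case split_last \<pi> of (\<alpha>, \<beta>) \<Rightarrow> mu \<alpha> \<ominus> (mu (psi \<beta>) \<oplus> [1]))"
  by pat_completeness auto
termination
  by (relation "measure length") (auto dest: length_split_last[OF _ sym])

declare mu.simps [simp del]

lemma psi_Nil: "psi [] = []"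
  by (simp add: psi.simps)

lemma psi_one_ominus:
  assumes "\<alpha> \<in> perms a"
  shows "psi ([1] \<ominus> \<alpha>) = [1] \<ominus> psi \<alpha>"
proof -
  have "split_max ([1] \<ominus> \<alpha>) = ([], \<alpha>)"
    using split_max_eq[of "[]" 0 \<alpha> a] assms by (simp add: perms_def osum_def)
  then show ?thesis by (subst psi.simps) (simp add: ominus_def)
qed

lemma psi_osum_ominus:
  assumes "\<alpha> \<in> perms a" "\<beta> \<in> perms b" "\<alpha> \<noteq> []" "\<beta> \<noteq> []"
    and "psi \<beta> = \<gamma> \<ominus> (\<delta> \<oplus> [1])" "\<gamma> \<in> perms c" "\<delta> \<in> perms d"
  shows "psi ((\<alpha> \<oplus> [1]) \<ominus> \<beta>) = ((psi \<alpha> \<ominus> (\<delta> \<oplus> [1])) \<oplus> [1]) \<ominus> \<gamma>"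
proof -
  have "(\<alpha> \<oplus> [1]) \<ominus> \<beta> \<noteq> []" by (simp add: ominus_def osum_def)
  then show ?thesis
    using assms(3,4) by (subst psi.simps)
      (simp add: split_max_eq[OF assms(1,2)] split_last_eq[OF assms(6,7)] assms(5) del: One_nat_def)
qed

lemma psi_osum_one:
  assumes "\<alpha> \<in> perms a" "\<alpha> \<noteq> []"
    and "psi \<alpha> = (\<gamma> \<oplus> [1]) \<ominus> \<delta>" "\<gamma> \<in> perms c" "\<delta> \<in> perms d"
  shows "psi (\<alpha> \<oplus> [1]) = ((\<gamma> \<oplus> [1]) \<oplus> [1]) \<ominus> \<delta>"
proof -
  have "split_max (\<alpha> \<oplus> [1]) = (\<alpha>, [])"
    using split_max_eq[OF assms(1), of "[]" 0] by (simp add: perms_def ominus_def)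
  moreover have "\<alpha> \<oplus> [1] \<noteq> []" by (simp add: osum_def)
  ultimately show ?thesis
    using assms(2) by (subst psi.simps)
      (simp add: split_max_eq[OF assms(4,5)] assms(3) del: One_nat_def)
qed

lemma mu_Nil: "mu [] = []"
  by (simp add: mu.simps)

lemma mu_ominus:
  assumes "\<alpha> \<in> perms a" "\<beta> \<in> perms b"
  shows "mu (\<alpha> \<ominus> (\<beta> \<oplus> [1])) = mu \<alpha> \<ominus> (mu (psi \<beta>) \<oplus> [1])"
proof -
  have "\<alpha> \<ominus> (\<beta> \<oplus> [1]) \<noteq> []" by (simp add: ominus_def osum_def)
  then show ?thesis
    by (subst mu.simps) (simp add: split_last_eq[OF assms] del: One_nat_def)
qed

end

theory Submission
  imports Defs
begin

text \<open>
  Every statistic is additive, up to an explicit correction, under \<open>\<alpha> \<ominus> \<beta>\<close> and \<open>\<alpha> \<oplus> 1\<close>.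
  For \<open>\<pi> = \<alpha> \<ominus> (\<beta> \<oplus> 1)\<close> this gives \<open>C (\<mu> \<pi>) = C (\<mu> \<alpha>) + C (\<mu> (\<psi> \<beta>)) + des (\<mu> (\<psi> \<beta>))\<close> and,
  for nonempty \<open>\<beta>\<close>, \<open>B \<pi> = B \<alpha> + B \<beta> + \<bar>\<beta>\<bar> - 1 - L \<beta>\<close>. So the theorem reduces, by induction on the
  length, to the identities \<open>des (\<psi> \<beta>) = des \<beta>\<close> and \<open>B (\<psi> \<beta>) + des \<beta> = B \<beta> + \<bar>\<beta>\<bar> - 1 - L \<beta>\<close>,
  which pass through the three clauses defining \<open>\<psi>\<close>.
\<close>

section \<open>Permutations in one-line notation\<close>

lemma perms_iff: "\<pi> \<in> perms n \<longleftrightarrow> set \<pi> = {1..n} \<and> distinct \<pi>"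
  by (auto simp: perms_def permutations_of_set_def)

lemma length_perms: "\<pi> \<in> perms n \<Longrightarrow> length \<pi> = n"
  by (auto simp: perms_iff distinct_card[symmetric])

lemma nth_perms_bounds:
  assumes "\<pi> \<in> perms n" "i < n"
  shows "1 \<le> \<pi> ! i" "\<pi> ! i \<le> n"
proof -
  have "\<pi> ! i \<in> set \<pi>" using assms by (simp add: length_perms)
  then show "1 \<le> \<pi> ! i" "\<pi> ! i \<le> n" using assms(1) by (auto simp: perms_iff)
qed

lemma Nil_in_perms_iff [simp]: "[] \<in> perms n \<longleftrightarrow> n = 0"
  by (auto simp: perms_iff)

lemma perms_0 [simp]: "\<pi> \<in> perms 0 \<longleftrightarrow> \<pi> = []"
  by (auto simp: perms_iff)

section \<open>Rewrite rules for sums and skew sums\<close>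

lemma ominus_Nil [simp]: "\<alpha> \<ominus> [] = \<alpha>" "[] \<ominus> \<alpha> = \<alpha>"
  by (simp_all add: ominus_def)

lemma Nil_osum [simp]: "[] \<oplus> \<alpha> = \<alpha>"
  by (simp add: osum_def)

lemma osum_one_neq_Nil [simp]: "\<alpha> \<oplus> [x] \<noteq> []"
  by (simp add: osum_def)

lemma ominus_eq_Nil_iff [simp]: "\<alpha> \<ominus> \<beta> = [] \<longleftrightarrow> \<alpha> = [] \<and> \<beta> = []"
  by (simp add: ominus_def)

lemma ominus_assoc: "\<alpha> \<ominus> \<beta> \<ominus> \<gamma> = \<alpha> \<ominus> (\<beta> \<ominus> \<gamma>)"
  by (simp add: ominus_def ac_simps)

lemma length_ominus [simp]: "length (\<alpha> \<ominus> \<beta>) = length \<alpha> + length \<beta>"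
  by (simp add: ominus_def)

lemma length_osum [simp]: "length (\<alpha> \<oplus> \<beta>) = length \<alpha> + length \<beta>"
  by (simp add: osum_def)

lemma nth_ominus:
  "i < length \<alpha> + length \<beta> \<Longrightarrow>
    (\<alpha> \<ominus> \<beta>) ! i = (if i < length \<alpha> then \<alpha> ! i + length \<beta> else \<beta> ! (i - length \<alpha>))"
  by (auto simp: ominus_def nth_append)

lemma nth_osum_one:
  "i \<le> length \<alpha> \<Longrightarrow> (\<alpha> \<oplus> [1]) ! i = (if i < length \<alpha> then \<alpha> ! i else length \<alpha> + 1)"
  by (auto simp: osum_def nth_append)

text \<open>The form \<open>[Suc 0]\<close> is the one into which simplification turns
  \<open>[1]\<close>, so the rule can fire.\<close>

lemma last_osum_one [simp]: "last (\<alpha> \<oplus> [Suc 0]) = length \<alpha> + 1"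
  by (simp add: osum_def)

lemma last_ominus [simp]: "\<beta> \<noteq> [] \<Longrightarrow> last (\<alpha> \<ominus> \<beta>) = last \<beta>"
  by (simp add: ominus_def)

lemma ominus_in_perms:
  assumes "\<alpha> \<in> perms a" "\<beta> \<in> perms b"
  shows "\<alpha> \<ominus> \<beta> \<in> perms (a + b)"
proof -
  have "(\<lambda>x. x + b) ` {1..a} = {b + 1..a + b}"
    by (simp add: image_add_atLeastAtMost' add.commute)
  moreover have "{b + 1..a + b} \<union> {1..b} = {1..a + b}" by auto
  ultimately show ?thesis
    using assms length_perms[OF assms(2)]
    by (auto simp: perms_iff ominus_def distinct_map)
qed

lemma osum_one_in_perms:
  assumes "\<alpha> \<in> perms a"
  shows "\<alpha> \<oplus> [1] \<in> perms (a + 1)"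
  using assms length_perms[OF assms] by (auto simp: perms_iff osum_def)

section \<open>Decompositions of 132-avoiding permutations\<close>

lemma perms_132_imp_perms: "\<pi> \<in> perms_132 n \<Longrightarrow> \<pi> \<in> perms n"
  by (simp add: perms_132_def)

lemma avoids_132D:
  "avoids_132 \<pi> \<Longrightarrow> i < j \<Longrightarrow> j < k \<Longrightarrow> k < length \<pi> \<Longrightarrow> \<pi> ! i < \<pi> ! k \<Longrightarrow> \<pi> ! k < \<pi> ! j \<Longrightarrow> False"
  by (auto simp: avoids_132_def)

section \<open>Constructions that preserve 132-avoidance\<close>

lemma Nil_in_perms_132 [simp]: "[] \<in> perms_132 0"
  by (simp add: perms_132_def avoids_132_def)

text \<open>In a pattern 132 the last entry exceeds the first, while every entry of the left block
  exceeds every entry of the right one. So an occurrence cannot straddle the two blocks.\<close>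

lemma ominus_in_perms_132:
  assumes "\<alpha> \<in> perms_132 a" "\<beta> \<in> perms_132 b"
  shows "\<alpha> \<ominus> \<beta> \<in> perms_132 (a + b)"
proof -
  have p: "\<alpha> \<in> perms a" "\<beta> \<in> perms b" and av: "avoids_132 \<alpha>" "avoids_132 \<beta>"
    using assms by (auto simp: perms_132_def)
  note len = length_perms[OF p(1)] length_perms[OF p(2)]
  have "avoids_132 (\<alpha> \<ominus> \<beta>)"
    unfolding avoids_132_def
  proof clarify
    fix i j k
    assume *: "i < j" "j < k" "k < length (\<alpha> \<ominus> \<beta>)"
      "(\<alpha> \<ominus> \<beta>) ! i < (\<alpha> \<ominus> \<beta>) ! k" "(\<alpha> \<ominus> \<beta>) ! k < (\<alpha> \<ominus> \<beta>) ! j"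
    consider "k < a" | "i < a" "a \<le> k" | "a \<le> i" by linarith
    then show False
    proof cases
      case 1
      then show False
        using * av(1) by (fastforce simp: nth_ominus len avoids_132_def)
    next
      case 2
      then have "k - a < b" using * len by auto
      then show False
        using 2 * nth_perms_bounds(2)[OF p(2), of "k - a"]
        by (auto simp: nth_ominus len split: if_splits)
    next
      case 3
      then have "i - a < j - a" "j - a < k - a" "k - a < length \<beta>"
        "\<beta> ! (i - a) < \<beta> ! (k - a)" "\<beta> ! (k - a) < \<beta> ! (j - a)"
        using * by (auto simp: nth_ominus len)
      then show False using av(2) unfolding avoids_132_def by blast
    qed
  qed
  then show ?thesis using ominus_in_perms[OF p] by (simp add: perms_132_def)
qed

text \<open>The appended entry could only be the last entry of a pattern 132, but there the middle
  entry is larger, and nothing exceeds the new maximum.\<close>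

lemma osum_one_in_perms_132:
  assumes "\<alpha> \<in> perms_132 a"
  shows "\<alpha> \<oplus> [1] \<in> perms_132 (a + 1)"
proof -
  have p: "\<alpha> \<in> perms a" and av: "avoids_132 \<alpha>"
    using assms by (auto simp: perms_132_def)
  have "avoids_132 (\<alpha> \<oplus> [1])"
    unfolding avoids_132_def
  proof clarify
    fix i j k
    assume *: "i < j" "j < k" "k < length (\<alpha> \<oplus> [1])"
      "(\<alpha> \<oplus> [1]) ! i < (\<alpha> \<oplus> [1]) ! k" "(\<alpha> \<oplus> [1]) ! k < (\<alpha> \<oplus> [1]) ! j"
    show False
    proof (cases "k < a")
      case True
      then have "\<alpha> ! i < \<alpha> ! k" "\<alpha> ! k < \<alpha> ! j" "k < length \<alpha>"
        using * by (auto simp: nth_osum_one length_perms[OF p] simp del: One_nat_def)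
      then show False using * av unfolding avoids_132_def by blast
    next
      case False
      then show False
        using * nth_perms_bounds(2)[OF p, of j]
        by (auto simp: nth_osum_one length_perms[OF p] simp del: One_nat_def)
    qed
  qed
  then show ?thesis using osum_one_in_perms[OF p] by (simp add: perms_132_def)
qed

section \<open>Cutting at the maximum and at the last entry\<close>

lemma atLeastAtMost_eq_if_downward_closed:
  fixes Y :: "nat set"
  assumes "finite Y" "0 \<notin> Y" and "\<And>x y. y \<in> Y \<Longrightarrow> 1 \<le> x \<Longrightarrow> x \<le> y \<Longrightarrow> x \<in> Y"
  shows "Y = {1..card Y}"
proof (cases "Y = {}")
  case False
  have "Y = {1..Max Y}"
  proof (intro equalityI subsetI)
    fix x assume "x \<in> Y"
    then have "x \<noteq> 0" "x \<le> Max Y" using assms(1,2) by (metis, simp)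
    then show "x \<in> {1..Max Y}" by simp
  next
    fix x assume "x \<in> {1..Max Y}"
    then show "x \<in> Y" using assms(3)[of "Max Y" x] Max_in[OF assms(1) False] by simp
  qed
  then show ?thesis by (metis card_atLeastAtMost diff_Suc_1 One_nat_def)
qed simp

text \<open>Avoidance forces all entries before the maximum above all entries after it. The two
  sides therefore occupy complementary intervals of values, and lowering the left one gives
  \<open>\<alpha>\<close>.\<close>

lemma perms_132_split_max:
  assumes "\<pi> \<in> perms_132 n" "\<pi> \<noteq> []"
  obtains \<alpha> \<beta> a b where "\<alpha> \<in> perms_132 a" "\<beta> \<in> perms_132 b" "\<pi> = (\<alpha> \<oplus> [1]) \<ominus> \<beta>" "n = a + b + 1"
proof -
  have set: "set \<pi> = {1..n}" and dist: "distinct \<pi>" and av: "avoids_132 \<pi>"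
    using assms(1) by (auto simp: perms_132_def perms_iff)
  have "n > 0" using assms(2) set by (cases n) auto
  then have "n \<in> set \<pi>" using set by auto
  then obtain xs ys where \<pi>: "\<pi> = xs @ n # ys" by (meson split_list)
  \<comment> \<open>Otherwise \<open>x\<close>, \<open>n\<close>, \<open>y\<close> would be an
    occurrence of 132; in \<open>\<pi>\<close> they stand at positions \<open>i\<close>,
    \<open>length xs\<close> and \<open>length xs + j + 1\<close>.\<close>
  have gt: "y < x" if xy: "x \<in> set xs" "y \<in> set ys" for x y
  proof (rule ccontr)
    assume "\<not> y < x"
    moreover have "x \<noteq> y" using xy dist \<pi> by auto
    ultimately have "x < y" by simp
    moreover have "y < n" using xy set dist \<pi> by (cases "y = n") auto
    moreover obtain i j where "i < length xs" "xs ! i = x" "j < length ys" "ys ! j = y"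
      using xy by (metis in_set_conv_nth)
    ultimately show False
      using avoids_132D[OF av, of i "length xs" "length xs + j + 1"]
      by (auto simp: \<pi> nth_append)
  qed
  define b where "b = length ys"
  have sets: "set xs \<union> set ys = {1..n} - {n}" "set xs \<inter> set ys = {}"
    using set dist \<pi> by auto
  \<comment> \<open>A value below some entry of \<open>ys\<close> differs from \<open>n\<close> and,
    by \<open>gt\<close>, is not in \<open>xs\<close>. So \<open>set ys\<close> is closed downwards
    and must be an initial interval.\<close>
  have "set ys = {1..card (set ys)}"
  proof (rule atLeastAtMost_eq_if_downward_closed)
    show "0 \<notin> set ys"
    proof
      assume "0 \<in> set ys"
      then have "0 \<in> {1..n} - {n}" using sets(1) by blast
      then show False by simp
    qed
    fix x y assume *: "y \<in> set ys" "1 \<le> x" "x \<le> y"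
    moreover have "y \<in> {1..n} - {n}" using * sets(1) by blast
    ultimately have "x \<in> set xs \<union> set ys" unfolding sets(1) by auto
    then show "x \<in> set ys" using gt[of x y] * by auto
  qed simp
  then have ys: "set ys = {1..b}" using dist \<pi> by (simp add: b_def distinct_card)
  \<comment> \<open>Makes the cardinality \<open>n - 1 - b\<close> of the interval
    \<open>{b + 1..n - 1}\<close> free of truncation.\<close>
  have bn: "b < n"
  proof -
    have "set ys \<subseteq> {1..n} - {n}" using sets(1) by auto
    then show ?thesis using ys \<open>n > 0\<close> by (cases b) auto
  qed
  have xs: "set xs = {b + 1..n - 1}"
  proof -
    have "set xs = ({1..n} - {n}) - {1..b}" using sets ys by blast
    also have "\<dots> = {b + 1..n - 1}" by auto
    finally show ?thesis .
  qed
  define a where "a = length xs"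
  have n: "n = a + b + 1"
  proof -
    have "a = card (set xs)" using dist \<pi> by (simp add: a_def distinct_card)
    then show ?thesis using xs bn by simp
  qed
  define \<alpha> where "\<alpha> = map (\<lambda>x. x - b) xs"
  \<comment> \<open>All entries of \<open>xs\<close> exceed \<open>b\<close>, so the truncated
    subtraction in \<open>\<alpha>\<close> can be undone.\<close>
  have xs_eq: "xs = map (\<lambda>x. x + b) \<alpha>"
    unfolding \<alpha>_def map_map comp_def by (rule map_idI[symmetric]) (use xs in auto)
  have "set \<alpha> = {1..a}"
  proof -
    have "set \<alpha> = (\<lambda>x. x - b) ` {1 + b..a + b}" using xs n by (simp add: \<alpha>_def add.commute)
    also have "\<dots> = (\<lambda>x. x - b) ` (\<lambda>x. x + b) ` {1..a}" by (simp add: image_add_atLeastAtMost')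
    also have "\<dots> = {1..a}" by (simp only: image_image) simp
    finally show ?thesis .
  qed
  moreover have "distinct \<alpha>" using dist \<pi> xs_eq by (simp add: distinct_map)
  moreover have "avoids_132 \<alpha>"
    unfolding avoids_132_def
  proof clarify
    fix i j k
    assume "i < j" "j < k" "k < length \<alpha>" "\<alpha> ! i < \<alpha> ! k" "\<alpha> ! k < \<alpha> ! j"
    then show False
      using avoids_132D[OF av, of i j k]
      by (auto simp: \<pi> xs_eq nth_append)
  qed
  ultimately have A: "\<alpha> \<in> perms_132 a" by (simp add: perms_132_def perms_iff)
  have "avoids_132 ys"
    unfolding avoids_132_def
  proof clarify
    fix i j k
    assume "i < j" "j < k" "k < length ys" "ys ! i < ys ! k" "ys ! k < ys ! j"
    then show False
      using avoids_132D[OF av, of "a + 1 + i" "a + 1 + j" "a + 1 + k"]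
      by (auto simp: \<pi> a_def nth_append)
  qed
  then have B: "ys \<in> perms_132 b" using ys dist \<pi> by (simp add: perms_132_def perms_iff)
  have "\<pi> = (\<alpha> \<oplus> [1]) \<ominus> ys"
    using length_perms[OF perms_132_imp_perms[OF A]] n
    by (simp add: \<pi> xs_eq ominus_def osum_def b_def)
  then show thesis using that[OF A B] n by blast
qed

text \<open>Follows from the cut at the maximum by induction. If nothing stands after the maximum,
  the left part is empty; otherwise the tail is cut at its last entry, and associativity of
  \<open>\<ominus>\<close> moves everything in front of that cut into the left part.\<close>

lemma perms_132_split_last:
  assumes "\<pi> \<in> perms_132 n" "\<pi> \<noteq> []"
  obtains \<alpha> \<beta> a b where "\<alpha> \<in> perms_132 a" "\<beta> \<in> perms_132 b" "\<pi> = \<alpha> \<ominus> (\<beta> \<oplus> [1])" "n = a + b + 1"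
proof -
  have "\<exists>\<alpha> \<beta> a b. \<alpha> \<in> perms_132 a \<and> \<beta> \<in> perms_132 b \<and> \<pi> = \<alpha> \<ominus> (\<beta> \<oplus> [1]) \<and> n = a + b + 1"
    using assms
  proof (induction n arbitrary: \<pi> rule: less_induct)
    case (less n)
    obtain \<alpha> \<beta> a b where ab: "\<alpha> \<in> perms_132 a" "\<beta> \<in> perms_132 b" "\<pi> = (\<alpha> \<oplus> [1]) \<ominus> \<beta>" "n = a + b + 1"
      using less.prems by (rule perms_132_split_max)
    show ?case
    proof (cases "\<beta> = []")
      case True
      then have "\<pi> = [] \<ominus> (\<alpha> \<oplus> [1])" "b = 0"
        using ab perms_132_imp_perms[OF ab(2)] by simp_all
      then show ?thesis using ab Nil_in_perms_132 by (metis add_0 add_0_right)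
    next
      case False
      then obtain \<gamma> \<delta> c d where cd: "\<gamma> \<in> perms_132 c" "\<delta> \<in> perms_132 d"
        "\<beta> = \<gamma> \<ominus> (\<delta> \<oplus> [1])" "b = c + d + 1"
        using less.IH[of b \<beta>] ab by auto
      have "\<pi> = ((\<alpha> \<oplus> [1]) \<ominus> \<gamma>) \<ominus> (\<delta> \<oplus> [1])"
        using ab(3) cd(3) by (simp only: ominus_assoc)
      moreover have "(\<alpha> \<oplus> [1]) \<ominus> \<gamma> \<in> perms_132 ((a + 1) + c)"
        by (intro ominus_in_perms_132 osum_one_in_perms_132 ab cd)
      moreover have "n = ((a + 1) + c) + d + 1" using ab cd by simp
      ultimately show ?thesis using cd(2) by blast
    qed
  qed
  then show thesis using that by blast
qed

section \<open>The statistics of sums and skew sums\<close>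

lemma stats_Nil [simp]: "des [] = 0" "stat_B [] = 0" "stat_C [] = 0" "stat_L [] = 0"
  by (simp_all add: des_def stat_B_def stat_C_def stat_L_def)

lemma finite_des_set: "finite {i. i + 1 < length \<pi> \<and> P i}"
  by (rule finite_subset[of _ "{..<length \<pi>}"]) auto

lemma finite_stat_B_set: "finite {(i, j). i < j \<and> j + 1 < length \<pi> \<and> P i j}"
  by (rule finite_subset[of _ "{..<length \<pi>} \<times> {..<length \<pi>}"]) auto

lemma finite_stat_C_set: "finite {(i, k). i + 1 < k \<and> k < length \<pi> \<and> P i k}"
  by (rule finite_subset[of _ "{..<length \<pi>} \<times> {..<length \<pi>}"]) auto

lemma set_eq_pairI: "(\<And>x y. (x, y) \<in> A \<longleftrightarrow> (x, y) \<in> B) \<Longrightarrow> A = B"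
  by auto

text \<open>Turns membership in a shifted index set into a condition that can be decided once the
  position is known to lie in the left or the right block.\<close>

lemma image_add_Collect:
  fixes a :: nat
  shows "(\<lambda>i. i + a) ` {i. P i} = {i. a \<le> i \<and> P (i - a)}"
  by (auto intro!: image_eqI[where x = "_ - a"])

lemma image_add_Collect_pair:
  fixes a :: nat
  shows "(\<lambda>(i, j). (i + a, j + a)) ` {(i, j). P i j} = {(i, j). a \<le> i \<and> a \<le> j \<and> P (i - a) (j - a)}"
  by (auto intro!: image_eqI[where x = "(_ - a, _ - a)"])

section \<open>Statistics of a skew sum\<close>

context
  fixes \<alpha> \<beta> :: "nat list" and a b :: nat
  assumes \<alpha>: "\<alpha> \<in> perms a" and \<beta>: "\<beta> \<in> perms b"
begin

lemma nth_ominus_left: "i < a \<Longrightarrow> (\<alpha> \<ominus> \<beta>) ! i = \<alpha> ! i + b"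
  using length_perms[OF \<alpha>] length_perms[OF \<beta>] by (simp add: nth_ominus)

lemma nth_ominus_right: "a \<le> i \<Longrightarrow> i < a + b \<Longrightarrow> (\<alpha> \<ominus> \<beta>) ! i = \<beta> ! (i - a)"
  using length_perms[OF \<alpha>] length_perms[OF \<beta>] by (simp add: nth_ominus)

lemma nth_ominus_less:
  assumes "i < a" "a \<le> j" "j < a + b"
  shows "(\<alpha> \<ominus> \<beta>) ! j < (\<alpha> \<ominus> \<beta>) ! i"
proof -
  have "j - a < b" using assms by linarith
  then show ?thesis
    using assms nth_perms_bounds(1)[OF \<alpha>, of i] nth_perms_bounds(2)[OF \<beta>, of "j - a"]
    by (simp add: nth_ominus_left nth_ominus_right)
qed

lemma des_ominus:
  "des (\<alpha> \<ominus> \<beta>) = des \<alpha> + des \<beta> + (if \<alpha> = [] \<or> \<beta> = [] then 0 else 1)"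
proof (cases "\<alpha> = [] \<or> \<beta> = []")
  case False
  note len = length_perms[OF \<alpha>] length_perms[OF \<beta>]
  have pos: "0 < a" "0 < b" using False len by auto
  let ?A = "{i. i + 1 < length \<alpha> \<and> \<alpha> ! i > \<alpha> ! (i + 1)}"
  let ?B = "{i. i + 1 < length \<beta> \<and> \<beta> ! i > \<beta> ! (i + 1)}"
  \<comment> \<open>The extra element \<open>a - 1\<close> is the last position of the left block:
    the step across the seam is always a descent when both blocks are nonempty.\<close>
  have "{i. i + 1 < length (\<alpha> \<ominus> \<beta>) \<and> (\<alpha> \<ominus> \<beta>) ! i > (\<alpha> \<ominus> \<beta>) ! (i + 1)} =
      insert (a - 1) (?A \<union> (\<lambda>i. i + a) ` ?B)" (is "?L = ?R")
  proof (rule set_eqI)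
    fix i
    consider "i + 1 < a" | "i + 1 = a" | "a \<le> i" by linarith
    then show "i \<in> ?L \<longleftrightarrow> i \<in> ?R"
    proof cases
      case 1
      then show ?thesis unfolding image_add_Collect by (auto simp: nth_ominus_left len)
    next
      case 2
      then show ?thesis using nth_ominus_less[of i a] pos len by auto
    next
      case 3
      then show ?thesis
        unfolding image_add_Collect using pos by (auto simp: nth_ominus_right len Suc_diff_le)
    qed
  qed
  moreover have "a - 1 \<notin> ?A" using len pos by simp
  moreover have "a - 1 \<notin> (\<lambda>i. i + a) ` ?B" using pos by auto
  moreover have "finite (?A \<union> (\<lambda>i. i + a) ` ?B)"
    by (intro finite_UnI finite_imageI finite_des_set)
  moreover have "card (?A \<union> (\<lambda>i. i + a) ` ?B) = card ?A + card ?B"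
    by (subst card_Un_disjoint)
      (use finite_des_set[of \<alpha>] finite_des_set[of \<beta>] len in \<open>auto simp: card_image inj_on_def\<close>)
  ultimately show ?thesis using False by (simp add: des_def)
qed auto

text \<open>An occurrence needs the entry at \<open>i\<close> to be smaller than the one at
  \<open>j + 1\<close>. By \<open>nth_ominus_less\<close> this fails when \<open>i\<close> is in the
  left and \<open>j + 1\<close> in the right block, so each occurrence lies within one
  block.\<close>

lemma stat_B_ominus: "stat_B (\<alpha> \<ominus> \<beta>) = stat_B \<alpha> + stat_B \<beta>"
proof -
  note len = length_perms[OF \<alpha>] length_perms[OF \<beta>]
  let ?S = "\<lambda>\<pi>::nat list. {(i, j). i < j \<and> j + 1 < length \<pi> \<and> \<pi> ! j < \<pi> ! i \<and> \<pi> ! i < \<pi> ! (j + 1)}"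
  have "(i, j) \<in> ?S (\<alpha> \<ominus> \<beta>) \<longleftrightarrow> (i, j) \<in> ?S \<alpha> \<union> (\<lambda>(i, j). (i + a, j + a)) ` ?S \<beta>" for i j
  proof -
    consider "i < j" "j + 1 < a" | "i < j" "i < a" "a \<le> j + 1" | "i < j" "a \<le> i" | "\<not> i < j" by linarith
    then show ?thesis
    proof cases
      case 1
      then show ?thesis unfolding image_add_Collect_pair by (auto simp: nth_ominus_left len)
    next
      case 2
      then show ?thesis
        unfolding image_add_Collect_pair using nth_ominus_less[of i "j + 1"] len by auto
    next
      case 3
      then show ?thesis
        unfolding image_add_Collect_pair by (auto simp: nth_ominus_right len Suc_diff_le)
    qed (auto simp: image_add_Collect_pair)
  qed
  then have "?S (\<alpha> \<ominus> \<beta>) = ?S \<alpha> \<union> (\<lambda>(i, j). (i + a, j + a)) ` ?S \<beta>" by (rule set_eq_pairI)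
  moreover have "card (?S \<alpha> \<union> (\<lambda>(i, j). (i + a, j + a)) ` ?S \<beta>) = card (?S \<alpha>) + card (?S \<beta>)"
    by (subst card_Un_disjoint)
      (use finite_stat_B_set[of \<alpha>] finite_stat_B_set[of \<beta>] len in \<open>auto simp: card_image inj_on_def\<close>)
  ultimately show ?thesis by (simp add: stat_B_def)
qed

text \<open>As for \<open>stat_B\<close>, with the entries at \<open>i\<close> and \<open>k\<close>
  as the pair that cannot straddle the seam.\<close>

lemma stat_C_ominus: "stat_C (\<alpha> \<ominus> \<beta>) = stat_C \<alpha> + stat_C \<beta>"
proof -
  note len = length_perms[OF \<alpha>] length_perms[OF \<beta>]
  let ?S = "\<lambda>\<pi>::nat list. {(i, k). i + 1 < k \<and> k < length \<pi> \<and> \<pi> ! (i + 1) < \<pi> ! i \<and> \<pi> ! i < \<pi> ! k}"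
  have "(i, k) \<in> ?S (\<alpha> \<ominus> \<beta>) \<longleftrightarrow> (i, k) \<in> ?S \<alpha> \<union> (\<lambda>(i, j). (i + a, j + a)) ` ?S \<beta>" for i k
  proof -
    consider "i + 1 < k" "k < a" | "i + 1 < k" "i < a" "a \<le> k" | "i + 1 < k" "a \<le> i" | "\<not> i + 1 < k"
      by linarith
    then show ?thesis
    proof cases
      case 1
      then show ?thesis unfolding image_add_Collect_pair by (auto simp: nth_ominus_left len)
    next
      case 2
      then show ?thesis
        unfolding image_add_Collect_pair using nth_ominus_less[of i k] len by auto
    next
      case 3
      then show ?thesis
        unfolding image_add_Collect_pair by (auto simp: nth_ominus_right len Suc_diff_le)
    qed (auto simp: image_add_Collect_pair)
  qed
  then have "?S (\<alpha> \<ominus> \<beta>) = ?S \<alpha> \<union> (\<lambda>(i, j). (i + a, j + a)) ` ?S \<beta>" by (rule set_eq_pairI)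
  moreover have "card (?S \<alpha> \<union> (\<lambda>(i, j). (i + a, j + a)) ` ?S \<beta>) = card (?S \<alpha>) + card (?S \<beta>)"
    by (subst card_Un_disjoint)
      (use finite_stat_C_set[of \<alpha>] finite_stat_C_set[of \<beta>] len in \<open>auto simp: card_image inj_on_def\<close>)
  ultimately show ?thesis by (simp add: stat_C_def)
qed

end

section \<open>The last entry and the statistic L\<close>

lemma stat_L_eq_last:
  assumes "\<pi> \<in> perms n" "\<pi> \<noteq> []"
  shows "stat_L \<pi> + 1 = last \<pi>"
proof -
  note len = length_perms[OF assms(1)]
  have dist: "distinct \<pi>" and set: "set \<pi> = {1..n}" using assms by (auto simp: perms_iff)
  have last: "last \<pi> = \<pi> ! (n - 1)" using assms(2) len by (simp add: last_conv_nth)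
  \<comment> \<open>Each value below the last entry occurs exactly once, and at an earlier position,
    so positions can be counted by their values.\<close>
  have "bij_betw (\<lambda>i. \<pi> ! i) {i. i + 1 < length \<pi> \<and> \<pi> ! i < last \<pi>} {1..<last \<pi>}"
  proof (rule bij_betw_imageI)
    show "inj_on (\<lambda>i. \<pi> ! i) {i. i + 1 < length \<pi> \<and> \<pi> ! i < last \<pi>}"
      using dist by (auto simp: inj_on_def nth_eq_iff_index_eq)
    show "(\<lambda>i. \<pi> ! i) ` {i. i + 1 < length \<pi> \<and> \<pi> ! i < last \<pi>} = {1..<last \<pi>}"
    proof (intro equalityI subsetI)
      fix x assume "x \<in> {1..<last \<pi>}"
      moreover have "last \<pi> \<le> n" using set assms(2) last_in_set[of \<pi>] by auto
      ultimately have "x \<in> set \<pi>" using set by auto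
      then obtain i where i: "i < n" "x = \<pi> ! i" using len by (metis in_set_conv_nth)
      moreover have "i \<noteq> n - 1" using i last \<open>x \<in> {1..<last \<pi>}\<close> by auto
      ultimately show "x \<in> (\<lambda>i. \<pi> ! i) ` {i. i + 1 < length \<pi> \<and> \<pi> ! i < last \<pi>}"
        using \<open>x \<in> {1..<last \<pi>}\<close> len by (intro image_eqI[of _ _ i]) auto
    qed (use nth_perms_bounds(1)[OF assms(1)] len in auto)
  qed
  from bij_betw_same_card[OF this] have "stat_L \<pi> = last \<pi> - 1" by (simp add: stat_L_def)
  moreover have "last \<pi> \<in> {1..n}" using set last_in_set[OF assms(2)] by simp
  ultimately show ?thesis by simp
qed

lemma stat_L_ominus:
  assumes "\<alpha> \<in> perms a" "\<beta> \<in> perms b" "\<beta> \<noteq> []"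
  shows "stat_L (\<alpha> \<ominus> \<beta>) = stat_L \<beta>"
  using stat_L_eq_last[OF ominus_in_perms[OF assms(1,2)]] stat_L_eq_last[OF assms(2)] assms(3)
  by simp

lemma stat_L_osum_one:
  assumes "\<alpha> \<in> perms a"
  shows "stat_L (\<alpha> \<oplus> [1]) = a"
  using stat_L_eq_last[OF osum_one_in_perms[OF assms]] length_perms[OF assms] by simp

section \<open>Statistics after appending a new maximum\<close>

context
  fixes \<alpha> :: "nat list" and a :: nat
  assumes \<alpha>: "\<alpha> \<in> perms a"
begin

lemma des_osum_one: "des (\<alpha> \<oplus> [1]) = des \<alpha>"
proof -
  note len = length_perms[OF \<alpha>]
  have "i + 1 < length (\<alpha> \<oplus> [1]) \<and> (\<alpha> \<oplus> [1]) ! i > (\<alpha> \<oplus> [1]) ! (i + 1) \<longleftrightarrow>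
      i + 1 < length \<alpha> \<and> \<alpha> ! i > \<alpha> ! (i + 1)" for i
    using nth_perms_bounds(2)[OF \<alpha>, of i] by (auto simp: nth_osum_one len simp del: One_nat_def split: if_splits)
  then show ?thesis unfolding des_def by presburger
qed

text \<open>Each descent of \<open>\<alpha>\<close>, together with the new maximum at position
  \<open>a\<close>, is one new occurrence.\<close>

lemma stat_C_osum_one: "stat_C (\<alpha> \<oplus> [1]) = stat_C \<alpha> + des \<alpha>"
proof -
  note len = length_perms[OF \<alpha>]
  let ?S = "\<lambda>\<pi>::nat list. {(i, k). i + 1 < k \<and> k < length \<pi> \<and> \<pi> ! (i + 1) < \<pi> ! i \<and> \<pi> ! i < \<pi> ! k}"
  let ?D = "{i. i + 1 < length \<alpha> \<and> \<alpha> ! i > \<alpha> ! (i + 1)}"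
  have "(i, k) \<in> ?S (\<alpha> \<oplus> [1]) \<longleftrightarrow> (i, k) \<in> ?S \<alpha> \<union> (\<lambda>i. (i, a)) ` ?D" for i k
    using nth_perms_bounds(2)[OF \<alpha>, of i] by (auto simp: nth_osum_one len simp del: One_nat_def split: if_splits)
  then have "?S (\<alpha> \<oplus> [1]) = ?S \<alpha> \<union> (\<lambda>i. (i, a)) ` ?D" by (rule set_eq_pairI)
  moreover have "card (?S \<alpha> \<union> (\<lambda>i. (i, a)) ` ?D) = card (?S \<alpha>) + card ?D"
    by (subst card_Un_disjoint)
      (use finite_stat_C_set[of \<alpha>] finite_des_set[of \<alpha>] len in \<open>auto simp: card_image inj_on_def\<close>)
  ultimately show ?thesis by (simp add: stat_C_def des_def)
qed

text \<open>A new occurrence must use the new ascent from \<open>last \<alpha>\<close> to the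
  maximum. Its first entry is any entry of \<open>\<alpha>\<close> above
  \<open>last \<alpha>\<close>, and there are \<open>a - 1 - stat_L \<alpha>\<close> of these. The
  additive form avoids truncated subtraction.\<close>

lemma stat_B_osum_one:
  assumes "\<alpha> \<noteq> []"
  shows "stat_B (\<alpha> \<oplus> [1]) + stat_L \<alpha> + 1 = stat_B \<alpha> + a"
proof -
  note len = length_perms[OF \<alpha>]
  have pos: "a > 0" using assms len by auto
  have last: "last \<alpha> = \<alpha> ! (a - 1)" using assms len by (simp add: last_conv_nth)
  let ?S = "\<lambda>\<pi>::nat list. {(i, j). i < j \<and> j + 1 < length \<pi> \<and> \<pi> ! j < \<pi> ! i \<and> \<pi> ! i < \<pi> ! (j + 1)}"
  let ?G = "{i. i + 1 < length \<alpha> \<and> last \<alpha> < \<alpha> ! i}"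
  let ?L = "{i. i + 1 < length \<alpha> \<and> \<alpha> ! i < last \<alpha>}"
  have "(i, j) \<in> ?S (\<alpha> \<oplus> [1]) \<longleftrightarrow> (i, j) \<in> ?S \<alpha> \<union> (\<lambda>i. (i, a - 1)) ` ?G" for i j
  proof -
    consider "j + 1 < a" | "j = a - 1" | "a < j + 1" "j \<noteq> a - 1" by linarith
    then show ?thesis
    proof cases
      case 2
      then show ?thesis using nth_perms_bounds(2)[OF \<alpha>, of i] pos last
        by (auto simp: nth_osum_one len simp del: One_nat_def split: if_splits)
    qed (auto simp: nth_osum_one len simp del: One_nat_def split: if_splits)
  qed
  then have "?S (\<alpha> \<oplus> [1]) = ?S \<alpha> \<union> (\<lambda>i. (i, a - 1)) ` ?G" by (rule set_eq_pairI)
  moreover have "card (?S \<alpha> \<union> (\<lambda>i. (i, a - 1)) ` ?G) = card (?S \<alpha>) + card ?G"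
    by (subst card_Un_disjoint)
      (use finite_stat_B_set[of \<alpha>] finite_des_set[of \<alpha>] len in \<open>auto simp: card_image inj_on_def\<close>)
  ultimately have "stat_B (\<alpha> \<oplus> [1]) = stat_B \<alpha> + card ?G" by (simp add: stat_B_def)
  \<comment> \<open>By distinctness the \<open>a - 1\<close> positions before the last one split
    into those with larger and those with smaller entries.\<close>
  moreover have "card ?G + card ?L = a - 1"
  proof -
    have "\<alpha> ! i \<noteq> last \<alpha>" if "i < a - 1" for i
      using that \<alpha> last len by (simp add: perms_iff nth_eq_iff_index_eq)
    then have "?G \<union> ?L = {..<a - 1}" using len by (auto simp: neq_iff)
    moreover have "card (?G \<union> ?L) = card ?G + card ?L"
      by (rule card_Un_disjoint) (use finite_des_set[of \<alpha>] in auto)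
    ultimately show ?thesis by simp
  qed
  ultimately show ?thesis using pos by (simp add: stat_L_def)
qed

end

section \<open>The maps psi and mu\<close>

text \<open>By \<open>stat_B_osum_one\<close> the last identity amounts to
  \<open>stat_B (psi \<pi>) + des \<pi> = stat_B (\<pi> \<oplus> [1])\<close>, the form in which
  \<open>mu_stats\<close> uses it. Membership belongs to the same induction because the clauses of
  \<open>psi\<close> cut values of \<open>psi\<close> again.\<close>

lemma psi_stats:
  assumes "\<pi> \<in> perms_132 n"
  shows "psi \<pi> \<in> perms_132 n \<and> des (psi \<pi>) = des \<pi> \<and>
    (\<pi> \<noteq> [] \<longrightarrow> stat_B (psi \<pi>) + des \<pi> + stat_L \<pi> + 1 = stat_B \<pi> + n)"
  using assms
proof (induction n arbitrary: \<pi> rule: less_induct)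
  case (less n)
  \<comment> \<open>Keeps \<open>[1]\<close> in the form in which the decomposition and statistic
    rules are stated.\<close>
  note [simp del] = One_nat_def
  show ?case
  proof (cases "\<pi> = []")
    case True
    then show ?thesis using less.prems by (simp add: psi_Nil)
  next
    case False
    obtain \<alpha> \<beta> a b where A: "\<alpha> \<in> perms_132 a" and B: "\<beta> \<in> perms_132 b"
      and \<pi>: "\<pi> = (\<alpha> \<oplus> [1]) \<ominus> \<beta>" and n: "n = a + b + 1"
      using perms_132_split_max[OF less.prems False] .
    note IHA = less.IH[OF _ A] and IHB = less.IH[OF _ B]
    note PA = perms_132_imp_perms[OF A] and PB = perms_132_imp_perms[OF B]
    have psiA: "psi \<alpha> \<in> perms_132 a" and psiB: "psi \<beta> \<in> perms_132 b" using IHA IHB n by auto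
    note PpA = perms_132_imp_perms[OF psiA] and PpB = perms_132_imp_perms[OF psiB]
    have ne: "psi \<alpha> = [] \<longleftrightarrow> \<alpha> = []" "psi \<beta> = [] \<longleftrightarrow> \<beta> = []"
      by (metis length_psi length_0_conv)+
    have one: "[1] \<in> perms_132 1" using osum_one_in_perms_132[OF Nil_in_perms_132] by simp
    have one_stats: "des [1] = 0" "stat_B [1] = 0" "stat_L [1] = 0"
      by (simp_all add: des_def stat_B_def stat_L_def)
    note P1 = perms_132_imp_perms[OF one]
    consider "\<alpha> = []" | "\<alpha> \<noteq> []" "\<beta> \<noteq> []" | "\<alpha> \<noteq> []" "\<beta> = []" by blast
    then show ?thesis
    proof cases
      case 1
      then have a: "a = 0" using A by (simp add: perms_132_def)
      have \<pi>: "\<pi> = [1] \<ominus> \<beta>" using \<pi> 1 by simp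
      have psi: "psi \<pi> = [1] \<ominus> psi \<beta>" unfolding \<pi> by (rule psi_one_ominus[OF PB])
      have "psi \<pi> \<in> perms_132 n"
        unfolding psi using ominus_in_perms_132[OF one psiB] n a by (simp add: add.commute)
      moreover have "des (psi \<pi>) = des \<pi>"
        unfolding psi unfolding \<pi> using IHB n ne by (simp add: des_ominus[OF P1 PpB] des_ominus[OF P1 PB])
      moreover have "stat_B (psi \<pi>) + des \<pi> + stat_L \<pi> + 1 = stat_B \<pi> + n"
      \<comment> \<open>The inductive identity for \<open>stat_B\<close> covers nonempty
        \<open>\<beta>\<close> only, so the one-element case is computed directly. Otherwise the new
        descent after the leading maximum balances \<open>n = b + 1\<close>.\<close>
      proof (cases "\<beta> = []")
        case True
        then show ?thesis using B n a unfolding psi unfolding \<pi> by (simp add: perms_132_def psi_Nil one_stats)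
      next
        case False
        then show ?thesis using IHB n a unfolding psi unfolding \<pi>
          by (simp add: des_ominus[OF P1 PB] stat_B_ominus[OF P1 PpB] stat_B_ominus[OF P1 PB]
              stat_L_ominus[OF P1 PB] one_stats)
      qed
      ultimately show ?thesis by blast
    next
      case 2
      then have nonempty: "psi \<beta> \<noteq> []" using ne by simp
      obtain \<gamma> \<delta> c d where C: "\<gamma> \<in> perms_132 c" and D: "\<delta> \<in> perms_132 d"
        and psi_\<beta>: "psi \<beta> = \<gamma> \<ominus> (\<delta> \<oplus> [1])" and b: "b = c + d + 1"
        using perms_132_split_last[OF psiB nonempty] .
      note PC = perms_132_imp_perms[OF C] and PD = perms_132_imp_perms[OF D]
      have psi: "psi \<pi> = ((psi \<alpha> \<ominus> (\<delta> \<oplus> [1])) \<oplus> [1]) \<ominus> \<gamma>"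
        unfolding \<pi> by (rule psi_osum_ominus[OF PA PB 2 psi_\<beta> PC PD])
      have PA1: "\<alpha> \<oplus> [1] \<in> perms (a + 1)" by (rule osum_one_in_perms[OF PA])
      have PD1: "\<delta> \<oplus> [1] \<in> perms (d + 1)" by (rule osum_one_in_perms[OF PD])
      have PE: "psi \<alpha> \<ominus> (\<delta> \<oplus> [1]) \<in> perms (a + (d + 1))" by (rule ominus_in_perms[OF PpA PD1])
      have PF: "(psi \<alpha> \<ominus> (\<delta> \<oplus> [1])) \<oplus> [1] \<in> perms (a + (d + 1) + 1)"
        by (rule osum_one_in_perms[OF PE])
      have "psi \<pi> \<in> perms_132 (a + (d + 1) + 1 + c)"
        unfolding psi by (intro ominus_in_perms_132 osum_one_in_perms_132 psiA C D)
      then have "psi \<pi> \<in> perms_132 n" using n b by (simp add: ac_simps)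
      moreover have des_\<pi>: "des \<pi> = des \<alpha> + des \<beta> + 1"
        unfolding \<pi> using 2 by (simp add: des_ominus[OF PA1 PB] des_osum_one[OF PA])
      \<comment> \<open>If \<open>\<gamma>\<close> is nonempty, the seam between
        \<open>\<gamma>\<close> and \<open>\<delta> \<oplus> [1]\<close> in
        \<open>psi \<beta>\<close> is replaced by the seam in front of \<open>\<gamma>\<close>. The
        summand 1 is the seam between \<open>psi \<alpha>\<close> and
        \<open>\<delta> \<oplus> [1]\<close>.\<close>
      moreover have "des (psi \<pi>) = des (psi \<alpha>) + des (psi \<beta>) + 1"
        unfolding psi psi_\<beta> using 2 ne
        by (simp add: des_ominus[OF PF PC] des_osum_one[OF PE] des_ominus[OF PpA PD1]
            des_osum_one[OF PD] des_ominus[OF PC PD1])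
      \<comment> \<open>The inner block ends in \<open>d + 1\<close>, and exactly the
        \<open>a\<close> entries coming from \<open>psi \<alpha>\<close> exceed this; the appended
        maximum thus adds \<open>a\<close> occurrences. The shares of \<open>\<gamma>\<close> and
        \<open>\<delta> \<oplus> [1]\<close> recombine to
        \<open>stat_B (psi \<beta>)\<close>.\<close>
      moreover have "stat_B (psi \<pi>) = stat_B (psi \<alpha>) + stat_B (psi \<beta>) + a"
        unfolding psi psi_\<beta> using stat_B_osum_one[OF PE]
        by (simp add: stat_B_ominus[OF PF PC] stat_B_ominus[OF PpA PD1] stat_B_ominus[OF PC PD1]
            stat_L_ominus[OF PpA PD1] stat_L_osum_one[OF PD])
      moreover have "stat_L \<pi> = stat_L \<beta>"
        unfolding \<pi> using 2 by (simp add: stat_L_ominus[OF PA1 PB])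
      moreover have "stat_B \<pi> + stat_L \<alpha> + 1 = stat_B \<alpha> + stat_B \<beta> + a"
        unfolding \<pi> using stat_B_osum_one[OF PA] 2 by (simp add: stat_B_ominus[OF PA1 PB])
      \<comment> \<open>The two inductive identities are added; \<open>stat_L \<alpha>\<close> also
        enters through \<open>stat_B \<pi>\<close> and cancels.\<close>
      ultimately show ?thesis using IHA IHB 2 n by simp
    next
      case 3
      then have b: "b = 0" using B by (simp add: perms_132_def)
      have \<pi>: "\<pi> = \<alpha> \<oplus> [1]" using \<pi> 3 by simp
      have nonempty: "psi \<alpha> \<noteq> []" using 3 ne by simp
      obtain \<gamma> \<delta> c d where C: "\<gamma> \<in> perms_132 c" and D: "\<delta> \<in> perms_132 d"
        and psi_\<alpha>: "psi \<alpha> = (\<gamma> \<oplus> [1]) \<ominus> \<delta>" and a: "a = c + d + 1"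
        using perms_132_split_max[OF psiA nonempty] .
      note PC = perms_132_imp_perms[OF C] and PD = perms_132_imp_perms[OF D]
      have psi: "psi \<pi> = ((\<gamma> \<oplus> [1]) \<oplus> [1]) \<ominus> \<delta>"
        unfolding \<pi> by (rule psi_osum_one[OF PA 3(1) psi_\<alpha> PC PD])
      have PC1: "\<gamma> \<oplus> [1] \<in> perms (c + 1)" by (rule osum_one_in_perms[OF PC])
      have PC2: "\<gamma> \<oplus> [1] \<oplus> [1] \<in> perms (c + 1 + 1)" by (rule osum_one_in_perms[OF PC1])
      have "psi \<pi> \<in> perms_132 (c + 1 + 1 + d)"
        unfolding psi by (intro ominus_in_perms_132 osum_one_in_perms_132 C D)
      then have "psi \<pi> \<in> perms_132 n" using n a b by (simp add: ac_simps)
      moreover have "des \<pi> = des \<alpha>" unfolding \<pi> by (rule des_osum_one[OF PA])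
      moreover have "des (psi \<pi>) = des (psi \<alpha>)"
        unfolding psi psi_\<alpha>
        by (simp add: des_ominus[OF PC2 PD] des_ominus[OF PC1 PD] des_osum_one[OF PC1])
      \<comment> \<open>Since \<open>\<gamma> \<oplus> [1]\<close> already ends in its maximum,
        appending another maximum creates no occurrence.\<close>
      moreover have "stat_B (psi \<pi>) = stat_B (psi \<alpha>)"
        unfolding psi psi_\<alpha> using stat_B_osum_one[OF PC1]
        by (simp add: stat_B_ominus[OF PC2 PD] stat_B_ominus[OF PC1 PD] stat_L_osum_one[OF PC])
      moreover have "stat_L \<pi> = a" unfolding \<pi> by (rule stat_L_osum_one[OF PA])
      moreover have "stat_B \<pi> + stat_L \<alpha> + 1 = stat_B \<alpha> + a"
        unfolding \<pi> using 3 by (intro stat_B_osum_one[OF PA])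
      ultimately show ?thesis using IHA 3 n b by simp
    qed
  qed
qed

text \<open>Membership is carried along so that the sum rules apply to the values of
  \<open>mu\<close>. The induction is on length because the recursion enters
  \<open>psi \<beta>\<close>, which need not be a part of \<open>\<pi>\<close> but has the same
  length as \<open>\<beta>\<close>.\<close>

lemma mu_stats:
  assumes "\<pi> \<in> perms_132 n"
  shows "mu \<pi> \<in> perms_132 n \<and> stat_C (mu \<pi>) = stat_B \<pi> \<and> des (mu \<pi>) = des \<pi> \<and> stat_L (mu \<pi>) = stat_L \<pi>"
  using assms
proof (induction n arbitrary: \<pi> rule: less_induct)
  case (less n)
  note [simp del] = One_nat_def
  show ?case
  proof (cases "\<pi> = []")
    case True
    then show ?thesis using less.prems by (simp add: mu_Nil)
  next
    case False
    obtain \<alpha> \<beta> a b where A: "\<alpha> \<in> perms_132 a" and B: "\<beta> \<in> perms_132 b"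
      and \<pi>: "\<pi> = \<alpha> \<ominus> (\<beta> \<oplus> [1])" and n: "n = a + b + 1"
      using perms_132_split_last[OF less.prems False] .
    note psiB = psi_stats[OF B]
    note IHA = less.IH[OF _ A] and IHB = less.IH[of b "psi \<beta>"]
    have mA: "mu \<alpha> \<in> perms_132 a" and mB: "mu (psi \<beta>) \<in> perms_132 b"
      using IHA IHB psiB n by auto
    note PA = perms_132_imp_perms[OF A] and PB = perms_132_imp_perms[OF B]
      and PmA = perms_132_imp_perms[OF mA] and PmB = perms_132_imp_perms[OF mB]
    note PB1 = osum_one_in_perms[OF PB] and PmB1 = osum_one_in_perms[OF PmB]
    have mu: "mu \<pi> = mu \<alpha> \<ominus> (mu (psi \<beta>) \<oplus> [1])" unfolding \<pi> by (rule mu_ominus[OF PA PB])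
    have "mu \<pi> \<in> perms_132 (a + (b + 1))"
      unfolding mu by (intro ominus_in_perms_132 osum_one_in_perms_132 mA mB)
    then have "mu \<pi> \<in> perms_132 n" using n by (simp add: ac_simps)
    \<comment> \<open>Emptiness of the left block decides whether the seam contributes a
      descent.\<close>
    moreover have "mu \<alpha> = [] \<longleftrightarrow> \<alpha> = []"
      using length_perms[OF PA] length_perms[OF PmA] by (metis length_0_conv)
    then have "des (mu \<pi>) = des \<pi>"
      unfolding mu unfolding \<pi> using IHA IHB psiB n
      by (simp add: des_ominus[OF PA PB1] des_ominus[OF PmA PmB1] des_osum_one[OF PB] des_osum_one[OF PmB])
    moreover have "stat_L (mu \<pi>) = stat_L \<pi>"
      unfolding mu unfolding \<pi>
      by (simp add: stat_L_ominus[OF PA PB1] stat_L_ominus[OF PmA PmB1] stat_L_osum_one[OF PB] stat_L_osum_one[OF PmB])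
    moreover have "stat_C (mu \<pi>) = stat_B \<alpha> + (stat_B (psi \<beta>) + des \<beta>)"
      unfolding mu using IHA IHB psiB n
      by (simp add: stat_C_ominus[OF PmA PmB1] stat_C_osum_one[OF PmB])
    \<comment> \<open>Here the two sides meet: the descents gained by \<open>stat_C\<close> through
      the appended maximum make up for the change of \<open>stat_B\<close> under \<open>psi\<close>.
      For empty \<open>\<beta>\<close> both sides are 0.\<close>
    moreover have "stat_B (psi \<beta>) + des \<beta> = stat_B (\<beta> \<oplus> [1])"
    proof (cases "\<beta> = []")
      case True
      then show ?thesis by (simp add: psi_Nil stat_B_def)
    next
      case False
      then show ?thesis using psiB stat_B_osum_one[OF PB] by simp
    qed
    ultimately show ?thesis unfolding \<pi> by (simp add: stat_B_ominus[OF PA PB1])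
  qed
qed

theorem theorem3:
  fixes n :: nat and \<pi> :: "nat list"
  assumes "\<pi> \<in> perms_132 n"
  shows "(stat_C (mu \<pi>), des (mu \<pi>), stat_L (mu \<pi>)) = (stat_B \<pi>, des \<pi>, stat_L \<pi>)"
  using mu_stats[OF assms] by simp

end
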